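(* Let $\mathbb T$ be a time scale, let $f:\mathbb T\to\mathbb R$ be a function and let $t\in\mathbb T_\kappa^\kappa$. 1. $f$ has at most one symmetric derivative at $t$. 2. If $f$ is symmetric differentiable at $t$, then $f$ is symmetric continuous at $t$. 3. If $f$ is continuous at $t$ and $t$ is not dense, then $f$ is symmetric differentiable at $t$ and $$f^\diamondsuit(t)=\frac{f^\sigma(t)-f^\rho(t)}{\sigma(t)-\rho(t)}.$$ 4. If $t$ is dense, then $f$ is symmetric differentiable at $t$ if and only if the limit $$\lim_{s\to t}\frac{-f(s)+f(2t-s)}{2t-2s}$$ exists as a finite number; in this case $$f^\diamondsuit(t)=\lim_{s\to t}\frac{-f(s)+f(2t-s)}{2t-2s}=\lim_{h\to0}\frac{f(t+h)-f(t-h)}{2h}.$$ 5. If $f$ is symmetric differentiable and continuous at $t$, then $$f^\sigma(t)=f^\rho(t)+f^\diamondsuit(t)\left[\sigma(t)-\rho(t)\right].$$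
   Context: A time scale $\mathbb T$ is a nonempty closed subset of $\mathbb R$ (with the relative topology; neighborhoods are in $\mathbb T$). $\sigma(t)=\inf\{s\in\mathbb T:s>t\}$ and $\rho(t)=\sup\{s\in\mathbb T:s<t\}$, with $\inf\emptyset=\sup\mathbb T$ and $\sup\emptyset=\inf\mathbb T$. A point $t$ is right-dense if $\sigma(t)=t$, right-scattered if $\sigma(t)>t$, left-dense if $\rho(t)=t$, left-scattered if $\rho(t)<t$, and dense if it is both right- and left-dense. $\mathbb T^\kappa$ is $\mathbb T$ minus its maximum if $\mathbb T$ has a left-scattered maximum, otherwise $\mathbb T$; $\mathbb T_\kappa$ is $\mathbb T$ minus its minimum if $\mathbb T$ has a right-scattered minimum, otherwise $\mathbb T$; $\mathbb T_\kappa^\kappa=\mathbb T_\kappa\cap\mathbb T^\kappa$. $f^\sigma=f\circ\sigma$, $f^\rho=f\circ\rho$. Symmetric continuity at $t$: for every $\varepsilon>0$ there is a neighborhood $U_t$ of $t$ such that $|f(s)-f(2t-s)|\le\varepsilon$ for all $s\in U_t$ for which $2t-s\in U_t$. Symmetric derivative: $f^\diamondsuit(t)$, for $t\in\mathbb T_\kappa^\kappa$, is the real number (if it exists; then $f$ is symmetric differentiable at $t$) such that for every $\varepsilon>0$ there is a neighborhood $U$ of $t$ such that, for all $s\in U$ for which $2t-s\in U$, $$\left|[f^\sigma(t)-f(s)+f(2t-s)-f^\rho(t)]-f^\diamondsuit(t)[\sigma(t)+2t-2s-\rho(t)]\right|\le\varepsilon\left|\sigma(t)+2t-2s-\rho(t)\right|.$$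 Limits as $s\to t$ are over $s\in\mathbb T\setminus\{t\}$ with $2t-s\in\mathbb T$, and limits as $h\to0$ over $h\ne0$ with $t\pm h\in\mathbb T$.
   Formalization: Item 1 assumes that if t is dense, then t is a limit point of the s in T with 2t−s in T; otherwise (e.g. T=[0,1], t=0) every real number is a symmetric derivative and uniqueness fails. *)

theory Defs
  imports "HOL-Analysis.Analysis"
begin

text \<open>A function on a time scale is represented by a total function on the reals; only its
  values at points of \<open>T\<close> are ever used.\<close>

definition time_scale :: "real set \<Rightarrow> bool" where
  "time_scale T \<longleftrightarrow> T \<noteq> {} \<and> closed T"

text \<open>The conventions \<open>inf {} = sup T\<close> and \<open>sup {} = inf T\<close> are spelled out, since \<open>Inf {}\<close> and
  \<open>Sup {}\<close> are unspecified on the reals. For \<open>t \<in> T\<close> the exceptional branches are only reached when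
  \<open>t\<close> is the maximum (minimum) of \<open>T\<close>, so \<open>Sup T\<close> (\<open>Inf T\<close>) is meaningful there.\<close>

definition jump_fwd :: "real set \<Rightarrow> real \<Rightarrow> real" where
  "jump_fwd T t = (if {s \<in> T. s > t} = {} then Sup T else Inf {s \<in> T. s > t})"

definition jump_bwd :: "real set \<Rightarrow> real \<Rightarrow> real" where
  "jump_bwd T t = (if {s \<in> T. s < t} = {} then Inf T else Sup {s \<in> T. s < t})"

definition right_dense :: "real set \<Rightarrow> real \<Rightarrow> bool" where
  "right_dense T t \<longleftrightarrow> jump_fwd T t = t"

definition right_scattered :: "real set \<Rightarrow> real \<Rightarrow> bool" where
  "right_scattered T t \<longleftrightarrow> jump_fwd T t > t"

definition left_dense :: "real set \<Rightarrow> real \<Rightarrow> bool" where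
  "left_dense T t \<longleftrightarrow> jump_bwd T t = t"

definition left_scattered :: "real set \<Rightarrow> real \<Rightarrow> bool" where
  "left_scattered T t \<longleftrightarrow> jump_bwd T t < t"

definition dense_pt :: "real set \<Rightarrow> real \<Rightarrow> bool" where
  "dense_pt T t \<longleftrightarrow> right_dense T t \<and> left_dense T t"

definition kappa_upper :: "real set \<Rightarrow> real set" where
  "kappa_upper T = T - {m \<in> T. (\<forall>s\<in>T. s \<le> m) \<and> left_scattered T m}"

definition kappa_lower :: "real set \<Rightarrow> real set" where
  "kappa_lower T = T - {m \<in> T. (\<forall>s\<in>T. m \<le> s) \<and> right_scattered T m}"

definition kappa_both :: "real set \<Rightarrow> real set" where
  "kappa_both T = kappa_lower T \<inter> kappa_upper T"

definition nbhd_in :: "real set \<Rightarrow> real \<Rightarrow> real set \<Rightarrow> bool" where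
  "nbhd_in T t U \<longleftrightarrow> U \<subseteq> T \<and> (\<exists>V. openin (top_of_set T) V \<and> t \<in> V \<and> V \<subseteq> U)"

definition symm_continuous :: "real set \<Rightarrow> (real \<Rightarrow> real) \<Rightarrow> real \<Rightarrow> bool" where
  "symm_continuous T f t \<longleftrightarrow>
     (\<forall>\<epsilon>>0. \<exists>U. nbhd_in T t U \<and>
        (\<forall>s\<in>U. 2 * t - s \<in> U \<longrightarrow> \<bar>f s - f (2 * t - s)\<bar> \<le> \<epsilon>))"

text \<open>The symmetric derivative is a relation between \<open>f\<close>, \<open>t\<close> and the value \<open>d\<close>, so that its
  uniqueness is something to be proved rather than built in.\<close>

definition has_symm_deriv :: "real set \<Rightarrow> (real \<Rightarrow> real) \<Rightarrow> real \<Rightarrow> real \<Rightarrow> bool" where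
  "has_symm_deriv T f t d \<longleftrightarrow>
     t \<in> kappa_both T \<and>
     (\<forall>\<epsilon>>0. \<exists>U. nbhd_in T t U \<and>
        (\<forall>s\<in>U. 2 * t - s \<in> U \<longrightarrow>
           \<bar>(f (jump_fwd T t) - f s + f (2 * t - s) - f (jump_bwd T t))
              - d * (jump_fwd T t + 2 * t - 2 * s - jump_bwd T t)\<bar>
           \<le> \<epsilon> * \<bar>jump_fwd T t + 2 * t - 2 * s - jump_bwd T t\<bar>))"

definition symm_differentiable :: "real set \<Rightarrow> (real \<Rightarrow> real) \<Rightarrow> real \<Rightarrow> bool" where
  "symm_differentiable T f t \<longleftrightarrow> (\<exists>d. has_symm_deriv T f t d)"

text \<open>The ranges of the variables in the limits as \<open>s\<close> tends to \<open>t\<close> and as \<open>h\<close> tends to \<open>0\<close>;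
  the filter \<open>at _ within _\<close> itself excludes the limit point.\<close>

definition symm_points :: "real set \<Rightarrow> real \<Rightarrow> real set" where
  "symm_points T t = {s \<in> T. 2 * t - s \<in> T}"

definition symm_increments :: "real set \<Rightarrow> real \<Rightarrow> real set" where
  "symm_increments T t = {h. t + h \<in> T \<and> t - h \<in> T}"

text \<open>At a dense point which is not a limit point of \<open>symm_points T t\<close> (for instance
  \<open>T = {0..1}\<close>, \<open>t = 0\<close>) the defining condition only tests \<open>s = t\<close>, where it reads \<open>0 \<le> 0\<close>, so
  every real number is a symmetric derivative of every function; see the lemma
  below. Uniqueness therefore needs the limits as \<open>s\<close> tends to \<open>t\<close> to be meaningful.\<close>

definition symm_accessible :: "real set \<Rightarrow> real \<Rightarrow> bool" where
  "symm_accessible T t \<longleftrightarrow> (dense_pt T t \<longrightarrow> t islimpt symm_points T t)"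

lemma not_symm_accessible_imp_has_symm_deriv:
  assumes "t \<in> kappa_both T" and "\<not> symm_accessible T t"
  shows "has_symm_deriv T f t d"
proof -
  have d: "jump_fwd T t = t" "jump_bwd T t = t" and n: "\<not> t islimpt symm_points T t"
    using assms(2) by (auto simp: symm_accessible_def dense_pt_def right_dense_def left_dense_def)
  have tT: "t \<in> T"
    using assms(1) by (auto simp: kappa_both_def kappa_lower_def)
  from n obtain V where V: "open V" "t \<in> V" "\<forall>y\<in>symm_points T t. y \<in> V \<longrightarrow> y = t"
    unfolding islimpt_def by blast
  have "nbhd_in T t (T \<inter> V)"
    unfolding nbhd_in_def using V tT openin_open_Int by blast
  moreover have "\<forall>s\<in>T \<inter> V. 2 * t - s \<in> T \<inter> V \<longrightarrow> s = t"
    using V by (auto simp: symm_points_def)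
  ultimately show ?thesis
    unfolding has_symm_deriv_def using assms(1) d by fastforce
qed

end

theory Submission
  imports Defs "HOL-Library.Landau_Symbols"
begin

text \<open>Taking \<open>s = t\<close> in the definition of the symmetric derivative yields the equality
  \<open>f\<^sup>\<sigma>(t) - f\<^sup>\<rho>(t) = d (\<sigma>(t) - \<rho>(t))\<close>, without any continuity. Subtracting it from the
  defining inequality leaves \<open>f(2t - s) - f(s) - d (2t - 2s) = o(\<sigma>(t) - \<rho>(t) + 2t - 2s)\<close> as \<open>s\<close> tends
  to \<open>t\<close>. If \<open>t\<close> is not dense, the right-hand side is bounded away from \<open>0\<close>, so this is symmetric
  continuity; if \<open>t\<close> is dense, it says that the symmetric difference quotient tends to \<open>d\<close>.\<close>

lemma kappa_both_subset: "kappa_both T \<subseteq> T"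
  by (auto simp: kappa_both_def kappa_lower_def)

lemma jump_fwd_ge:
  assumes "t \<in> T"
  shows "t \<le> jump_fwd T t"
proof (cases "{s \<in> T. s > t} = {}")
  case True
  \<comment> \<open>Nothing lies to the right of \<open>t\<close>, so \<open>t\<close> is the
    maximum of \<open>T\<close> and the convention for the empty infimum returns \<open>t\<close>
    itself.\<close>
  then have "Sup T = t"
    using assms by (intro cSup_eq_maximum) (auto simp: not_less)
  with True show ?thesis by (simp add: jump_fwd_def)
next
  case False
  then have "t \<le> Inf {s \<in> T. s > t}"
    by (intro cInf_greatest) auto
  with False show ?thesis unfolding jump_fwd_def by (simp only: if_False)
qed

lemma jump_bwd_le:
  assumes "t \<in> T"
  shows "jump_bwd T t \<le> t"
proof (cases "{s \<in> T. s < t} = {}")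
  case True
  then have "Inf T = t"
    using assms by (intro cInf_eq_minimum) (auto simp: not_less)
  with True show ?thesis by (simp add: jump_bwd_def)
next
  case False
  then have "Sup {s \<in> T. s < t} \<le> t"
    by (intro cSup_least) auto
  with False show ?thesis unfolding jump_bwd_def by (simp only: if_False)
qed

text \<open>The difference is the sum of the gaps on the two sides of \<open>t\<close>. Both are
  nonnegative, so it vanishes only if both do.\<close>

lemma dense_pt_iff_jump_eq:
  assumes "t \<in> T"
  shows "dense_pt T t \<longleftrightarrow> jump_fwd T t - jump_bwd T t = 0"
  using jump_fwd_ge[OF assms] jump_bwd_le[OF assms]
  by (auto simp: dense_pt_def right_dense_def left_dense_def)

text \<open>A neighborhood can be shrunk to the trace on \<open>T\<close> of a ball about
  \<open>t\<close>. The ball is invariant under the reflection of \<open>s\<close> to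
  \<open>2 * t - s\<close>, so inside it the side condition only says that the reflected point lies
  in \<open>T\<close>. The point \<open>s = t\<close> is split off because \<open>at\<close>
  excludes it.\<close>

lemma nbhd_in_symm_iff_eventually:
  assumes "t \<in> T"
  shows "(\<exists>U. nbhd_in T t U \<and> (\<forall>s\<in>U. 2 * t - s \<in> U \<longrightarrow> P s)) \<longleftrightarrow>
    P t \<and> (\<forall>\<^sub>F s in at t within symm_points T t. P s)"
proof (intro iffI conjI)
  assume "\<exists>U. nbhd_in T t U \<and> (\<forall>s\<in>U. 2 * t - s \<in> U \<longrightarrow> P s)"
  then obtain U V where V: "openin (top_of_set T) V" "t \<in> V" "V \<subseteq> U"
    and P: "\<And>s. s \<in> U \<Longrightarrow> 2 * t - s \<in> U \<Longrightarrow> P s"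
    unfolding nbhd_in_def by blast
  show "P t" using V P[of t] by auto
  obtain \<delta> where \<delta>: "\<delta> > 0" "ball t \<delta> \<inter> T \<subseteq> V"
    using V(1,2) by (auto simp: openin_contains_ball)
  have "P s" if "s \<in> symm_points T t" "dist s t < \<delta>" for s
  proof (rule P)
    show "s \<in> U" "2 * t - s \<in> U"
      using that \<delta> V by (auto simp: symm_points_def dist_real_def subset_iff abs_minus_commute)
  qed
  then show "\<forall>\<^sub>F s in at t within symm_points T t. P s"
    unfolding eventually_at using \<open>\<delta> > 0\<close> by blast
next
  assume "P t \<and> (\<forall>\<^sub>F s in at t within symm_points T t. P s)"
  then obtain \<delta> where "\<delta> > 0" and "P t"
    and "\<forall>s\<in>symm_points T t. s \<noteq> t \<and> dist s t < \<delta> \<longrightarrow> P s"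
    unfolding eventually_at by blast
  then have P: "P s" if "s \<in> symm_points T t" "dist s t < \<delta>" for s
    using that by (cases "s = t") auto
  have "openin (top_of_set T) (T \<inter> ball t \<delta>)"
    by (simp add: openin_open_Int)
  then have "nbhd_in T t (T \<inter> ball t \<delta>)"
    using assms \<open>\<delta> > 0\<close> by (auto simp: nbhd_in_def)
  moreover have "\<forall>s\<in>T \<inter> ball t \<delta>. 2 * t - s \<in> T \<inter> ball t \<delta> \<longrightarrow> P s"
    using P by (auto simp: symm_points_def dist_commute)
  ultimately show "\<exists>U. nbhd_in T t U \<and> (\<forall>s\<in>U. 2 * t - s \<in> U \<longrightarrow> P s)"
    by blast
qed

text \<open>The non-strict bound matches the definitions above; it comes from reading convergence to
  0 as o(1).\<close>

lemma tendsto_0_iff_eventually_le: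
  fixes g :: "'a \<Rightarrow> real"
  shows "(g \<longlongrightarrow> 0) F \<longleftrightarrow> (\<forall>\<epsilon>>0. \<forall>\<^sub>F x in F. \<bar>g x\<bar> \<le> \<epsilon>)"
proof -
  have "(g \<longlongrightarrow> 0) F \<longleftrightarrow> g \<in> o[F](\<lambda>_. 1)"
    by (auto intro: smalloI_tendsto dest: smalloD_tendsto)
  then show ?thesis
    by (simp add: smallo_def)
qed

lemma symm_continuous_iff_tendsto:
  assumes "t \<in> T"
  shows "symm_continuous T f t \<longleftrightarrow>
    ((\<lambda>s. f (2 * t - s) - f s) \<longlongrightarrow> 0) (at t within symm_points T t)"
  unfolding symm_continuous_def tendsto_0_iff_eventually_le nbhd_in_symm_iff_eventually[OF assms]
  by (simp add: abs_minus_commute)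

lemma has_symm_deriv_iff_smallo:
  "has_symm_deriv T f t d \<longleftrightarrow> t \<in> kappa_both T \<and>
    f (jump_fwd T t) - f (jump_bwd T t) = d * (jump_fwd T t - jump_bwd T t) \<and>
    (\<lambda>s. f (2 * t - s) - f s - d * (2 * t - 2 * s))
      \<in> o[at t within symm_points T t](\<lambda>s. jump_fwd T t - jump_bwd T t + (2 * t - 2 * s))"
    (is "_ \<longleftrightarrow> _ \<and> ?E \<and> ?O")
proof (cases "t \<in> kappa_both T")
  case True
  then have tT: "t \<in> T" using kappa_both_subset by blast
  \<comment> \<open>\<open>c\<close> is the value at \<open>s = t\<close> of the factor multiplied
    by \<open>d\<close>, and \<open>e\<close> that of the whole expression inside the absolute value
    on the left.\<close>
  define c where "c = jump_fwd T t - jump_bwd T t"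
  define e where "e = f (jump_fwd T t) - f (jump_bwd T t) - d * c"
  have "has_symm_deriv T f t d \<longleftrightarrow> (\<forall>\<epsilon>>0. \<bar>e\<bar> \<le> \<epsilon> * \<bar>c\<bar> \<and>
      (\<forall>\<^sub>F s in at t within symm_points T t.
        \<bar>e + (f (2 * t - s) - f s - d * (2 * t - 2 * s))\<bar> \<le> \<epsilon> * \<bar>c + (2 * t - 2 * s)\<bar>))"
    unfolding has_symm_deriv_def nbhd_in_symm_iff_eventually[OF tT]
    using True by (simp add: e_def c_def algebra_simps)
  also have "\<dots> \<longleftrightarrow> e = 0 \<and> ?O"
  proof -
    \<comment> \<open>Letting \<epsilon> decrease to 0 forces \<open>e = 0\<close>, whatever the
      value of \<open>c\<close>. What then remains is the definition of little-o verbatim.\<close>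
    have "((\<lambda>\<epsilon>. \<epsilon> * \<bar>c\<bar>) \<longlongrightarrow> 0 * \<bar>c\<bar>) (at_right 0)"
      by (intro tendsto_intros)
    then have "e = 0" if "\<forall>\<epsilon>>0. \<bar>e\<bar> \<le> \<epsilon> * \<bar>c\<bar>"
      using tendsto_lowerbound[of "\<lambda>\<epsilon>. \<epsilon> * \<bar>c\<bar>" 0 "at_right 0" "\<bar>e\<bar>"] that
      by (auto simp: eventually_at_filter)
    then show ?thesis
      by (auto simp: smallo_def c_def)
  qed
  finally show ?thesis using True by (simp add: e_def c_def)
qed (simp add: has_symm_deriv_def)

text \<open>The comparison function tends to the nonzero constant \<open>c\<close>, so being
  little-o of it just means tending to 0. The value \<open>d\<close> is then constrained by the jump
  equation alone.\<close>

lemma has_symm_deriv_scattered_iff: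
  assumes "\<not> dense_pt T t"
  shows "has_symm_deriv T f t d \<longleftrightarrow> t \<in> kappa_both T \<and>
    f (jump_fwd T t) - f (jump_bwd T t) = d * (jump_fwd T t - jump_bwd T t) \<and>
    symm_continuous T f t"
proof (cases "t \<in> kappa_both T")
  case True
  then have tT: "t \<in> T" using kappa_both_subset by blast
  define c where "c = jump_fwd T t - jump_bwd T t"
  define F where "F = at t within symm_points T t"
  have c: "c \<noteq> 0" using assms dense_pt_iff_jump_eq[OF tT] by (simp add: c_def)
  have id: "((\<lambda>s. s) \<longlongrightarrow> t) F"
    by (simp add: F_def)
  have lin: "((\<lambda>s. 2 * t - 2 * s) \<longlongrightarrow> 0) F"
    by (rule tendsto_eq_rhs[OF tendsto_diff[OF tendsto_const tendsto_mult[OF tendsto_const id]]])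
       simp
  have den: "((\<lambda>s. c + (2 * t - 2 * s)) \<longlongrightarrow> c) F"
    using tendsto_add[OF tendsto_const[of c] lin] by simp
  then have ev: "\<forall>\<^sub>F s in F. c + (2 * t - 2 * s) \<noteq> 0"
    using c by (rule tendsto_imp_eventually_ne)
  define N where "N = (\<lambda>s. f (2 * t - s) - f s - d * (2 * t - 2 * s))"
  have "N \<in> o[F](\<lambda>s. c + (2 * t - 2 * s)) \<longleftrightarrow> (N \<longlongrightarrow> 0) F"
  proof
    assume "N \<in> o[F](\<lambda>s. c + (2 * t - 2 * s))"
    then have "((\<lambda>s. N s / (c + (2 * t - 2 * s)) * (c + (2 * t - 2 * s))) \<longlongrightarrow> 0 * c) F"
      by (intro tendsto_mult den smalloD_tendsto)
    moreover have "\<forall>\<^sub>F s in F. N s / (c + (2 * t - 2 * s)) * (c + (2 * t - 2 * s)) = N s"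
      using ev by eventually_elim simp
    ultimately show "(N \<longlongrightarrow> 0) F"
      using Lim_transform_eventually by fastforce
  next
    assume "(N \<longlongrightarrow> 0) F"
    then have "((\<lambda>s. N s / (c + (2 * t - 2 * s))) \<longlongrightarrow> 0) F"
      using tendsto_divide[OF _ den c, of N 0] by simp
    then show "N \<in> o[F](\<lambda>s. c + (2 * t - 2 * s))"
      using ev by (rule smalloI_tendsto)
  qed
  also have "\<dots> \<longleftrightarrow> ((\<lambda>s. f (2 * t - s) - f s) \<longlongrightarrow> 0) F"
  proof -
    \<comment> \<open>The linear term vanishes in the limit, so adding or subtracting it passes
      between \<open>N\<close> and the symmetric difference.\<close>
    have dlin: "((\<lambda>s. d * (2 * t - 2 * s)) \<longlongrightarrow> 0) F"
      using tendsto_mult_right_zero[OF lin] .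
    show ?thesis
      using tendsto_add[OF _ dlin, of N 0]
        tendsto_diff[OF _ dlin, of "\<lambda>s. f (2 * t - s) - f s" 0]
      by (auto simp: N_def)
  qed
  finally show ?thesis
    unfolding has_symm_deriv_iff_smallo symm_continuous_iff_tendsto[OF tT] N_def c_def F_def
    by blast
qed (simp add: has_symm_deriv_def)

text \<open>Both jumps equal \<open>t\<close>, so the jump equation reads 0 = 0 and the comparison
  function is \<open>2 * t - 2 * s\<close>, which is nonzero for \<open>s\<close> other than
  \<open>t\<close>. Dividing by it gives the quotient minus \<open>d\<close>.\<close>

lemma has_symm_deriv_dense_iff:
  assumes "dense_pt T t" and "t \<in> kappa_both T"
  shows "has_symm_deriv T f t d \<longleftrightarrow>
    ((\<lambda>s. (- f s + f (2 * t - s)) / (2 * t - 2 * s)) \<longlongrightarrow> d) (at t within symm_points T t)"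
proof -
  let ?F = "at t within symm_points T t"
  have jumps: "jump_fwd T t = t" "jump_bwd T t = t"
    using assms(1) by (auto simp: dense_pt_def right_dense_def left_dense_def)
  have ev: "\<forall>\<^sub>F s in ?F. 2 * t - 2 * s \<noteq> 0"
    by (simp add: eventually_at_filter)
  let ?N = "\<lambda>s. f (2 * t - s) - f s - d * (2 * t - 2 * s)"
  have "has_symm_deriv T f t d \<longleftrightarrow> ?N \<in> o[?F](\<lambda>s. 2 * t - 2 * s)"
    using assms(2) by (simp add: has_symm_deriv_iff_smallo jumps)
  also have "\<dots> \<longleftrightarrow> ((\<lambda>s. ?N s / (2 * t - 2 * s)) \<longlongrightarrow> 0) ?F"
    by (rule iffI) (erule smalloD_tendsto, erule smalloI_tendsto[OF _ ev])
  also have "\<dots> \<longleftrightarrow> ((\<lambda>s. (- f s + f (2 * t - s)) / (2 * t - 2 * s) - d) \<longlongrightarrow> 0) ?F"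
    using ev by (intro tendsto_cong) (auto elim!: eventually_mono simp: field_simps)
  also have "\<dots> \<longleftrightarrow> ((\<lambda>s. (- f s + f (2 * t - s)) / (2 * t - 2 * s)) \<longlongrightarrow> d) ?F"
    by (rule LIM_zero_iff)
  finally show ?thesis .
qed

text \<open>At a dense point \<open>d\<close> is a limit along a filter that accessibility makes
  nontrivial. At any other point the jump equation determines \<open>d\<close>, since its
  coefficient is nonzero.\<close>

lemma has_symm_deriv_unique:
  assumes "symm_accessible T t" "has_symm_deriv T f t d" "has_symm_deriv T f t d'"
  shows "d = d'"
proof (cases "dense_pt T t")
  case True
  have "t \<in> kappa_both T" using assms(2) by (simp add: has_symm_deriv_def)
  moreover have "at t within symm_points T t \<noteq> bot"
    using True assms(1) by (simp add: symm_accessible_def trivial_limit_within)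
  ultimately show ?thesis
    using True assms(2,3) tendsto_unique by (simp add: has_symm_deriv_dense_iff) blast
next
  case False
  moreover have "t \<in> T"
    using assms(2) kappa_both_subset by (auto simp: has_symm_deriv_def)
  ultimately show ?thesis
    using assms(2,3) by (simp add: has_symm_deriv_iff_smallo dense_pt_iff_jump_eq)
qed

lemma has_symm_deriv_imp_symm_continuous:
  assumes "has_symm_deriv T f t d"
  shows "symm_continuous T f t"
proof (cases "dense_pt T t")
  case True
  let ?F = "at t within symm_points T t"
  let ?q = "\<lambda>s. (- f s + f (2 * t - s)) / (2 * t - 2 * s)"
  have t: "t \<in> kappa_both T" using assms by (simp add: has_symm_deriv_def)
  then have "(?q \<longlongrightarrow> d) ?F"
    using True assms has_symm_deriv_dense_iff by blast
  \<comment> \<open>Multiplying the convergent quotient by its denominator, which tends to 0,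
    recovers the symmetric difference.\<close>
  then have "((\<lambda>s. ?q s * (2 * t - 2 * s)) \<longlongrightarrow> d * (2 * t - 2 * t)) ?F"
    by (intro tendsto_intros)
  moreover have "\<forall>\<^sub>F s in ?F. ?q s * (2 * t - 2 * s) = f (2 * t - s) - f s"
    by (simp add: eventually_at_filter)
  ultimately have "((\<lambda>s. f (2 * t - s) - f s) \<longlongrightarrow> 0) ?F"
    using Lim_transform_eventually by fastforce
  then show ?thesis
    using t kappa_both_subset symm_continuous_iff_tendsto by blast
next
  case False
  then show ?thesis using assms has_symm_deriv_scattered_iff by blast
qed

lemma continuous_imp_symm_continuous:
  assumes "t \<in> T" "continuous (at t within T) f"
  shows "symm_continuous T f t"
proof -
  let ?F = "at t within symm_points T t"
  have f: "(f \<longlongrightarrow> f t) (at t within T)"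
    using assms(2) by (simp add: continuous_within)
  then have "(f \<longlongrightarrow> f t) ?F"
    by (rule tendsto_within_subset) (auto simp: symm_points_def)
  moreover have "((\<lambda>s. f (2 * t - s)) \<longlongrightarrow> f t) ?F"
  \<comment> \<open>To compose with the limit of \<open>f\<close> at \<open>t\<close> within
    \<open>T\<close>, the reflected point must tend to \<open>t\<close>, stay in \<open>T\<close>
    and differ from \<open>t\<close>.\<close>
  proof (rule filterlim_compose[OF f], unfold filterlim_at, intro conjI)
    show "((\<lambda>s. 2 * t - s) \<longlongrightarrow> t) ?F"
      by (rule tendsto_eq_intros refl | simp)+
    show "\<forall>\<^sub>F s in ?F. 2 * t - s \<in> T \<and> 2 * t - s \<noteq> t"
      by (auto simp: eventually_at_filter symm_points_def)
  qed
  ultimately have "((\<lambda>s. f (2 * t - s) - f s) \<longlongrightarrow> f t - f t) ?F"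
    by (intro tendsto_diff)
  then show ?thesis
    using assms(1) by (simp add: symm_continuous_iff_tendsto)
qed

text \<open>The substitution \<open>s = t - h\<close> turns \<open>2 * t - s\<close> into
  \<open>t + h\<close> and the denominator into \<open>2 * h\<close>.\<close>

lemma symm_quotient_tendsto_increments:
  assumes "((\<lambda>s. (- f s + f (2 * t - s)) / (2 * t - 2 * s)) \<longlongrightarrow> d) (at t within symm_points T t)"
  shows "((\<lambda>h. (f (t + h) - f (t - h)) / (2 * h)) \<longlongrightarrow> d) (at 0 within symm_increments T t)"
proof -
  have "filterlim (\<lambda>h. t - h) (at t within symm_points T t) (at 0 within symm_increments T t)"
    unfolding filterlim_at
  proof
    show "((\<lambda>h. t - h) \<longlongrightarrow> t) (at 0 within symm_increments T t)"
      by (rule tendsto_eq_intros refl | simp)+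
    show "\<forall>\<^sub>F h in at 0 within symm_increments T t. t - h \<in> symm_points T t \<and> t - h \<noteq> t"
      by (auto simp: eventually_at_filter symm_points_def symm_increments_def)
  qed
  from filterlim_compose[OF assms this] show ?thesis
    by (simp add: algebra_simps)
qed

theorem theorem8p2p5:
  fixes T :: "real set" and f :: "real \<Rightarrow> real" and t :: real
  assumes "time_scale T" and "t \<in> kappa_both T"
  shows
    "(symm_accessible T t \<longrightarrow>
        (\<forall>d d'. has_symm_deriv T f t d \<and> has_symm_deriv T f t d' \<longrightarrow> d = d'))
   \<and> (symm_differentiable T f t \<longrightarrow> symm_continuous T f t)
   \<and> (continuous (at t within T) f \<and> \<not> dense_pt T t \<longrightarrow>
        symm_differentiable T f t
        \<and> has_symm_deriv T f t
            ((f (jump_fwd T t) - f (jump_bwd T t)) / (jump_fwd T t - jump_bwd T t)))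
   \<and> (dense_pt T t \<longrightarrow>
        (symm_differentiable T f t \<longleftrightarrow>
           (\<exists>L. ((\<lambda>s. (- f s + f (2 * t - s)) / (2 * t - 2 * s)) \<longlongrightarrow> L)
                  (at t within symm_points T t)))
        \<and> (\<forall>d. has_symm_deriv T f t d \<longrightarrow>
             ((\<lambda>s. (- f s + f (2 * t - s)) / (2 * t - 2 * s)) \<longlongrightarrow> d)
               (at t within symm_points T t)
             \<and> ((\<lambda>h. (f (t + h) - f (t - h)) / (2 * h)) \<longlongrightarrow> d)
               (at 0 within symm_increments T t)))
   \<and> (\<forall>d. has_symm_deriv T f t d \<and> continuous (at t within T) f \<longrightarrow>
        f (jump_fwd T t) = f (jump_bwd T t) + d * (jump_fwd T t - jump_bwd T t))"
proof -
  have tT: "t \<in> T" using assms(2) kappa_both_subset by blast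
  let ?d = "(f (jump_fwd T t) - f (jump_bwd T t)) / (jump_fwd T t - jump_bwd T t)"
  \<comment> \<open>Continuity supplies symmetric continuity, and \<open>?d\<close> solves the jump
    equation because its denominator is nonzero.\<close>
  have scattered: "has_symm_deriv T f t ?d"
    if "continuous (at t within T) f" "\<not> dense_pt T t"
    using that assms(2) continuous_imp_symm_continuous[OF tT] dense_pt_iff_jump_eq[OF tT]
    by (simp add: has_symm_deriv_scattered_iff)
  have jump: "f (jump_fwd T t) = f (jump_bwd T t) + d * (jump_fwd T t - jump_bwd T t)"
    if "has_symm_deriv T f t d" for d
    using that unfolding has_symm_deriv_iff_smallo by linarith
  show ?thesis
    using has_symm_deriv_unique[of T t f] has_symm_deriv_imp_symm_continuous[of T f t]
      scattered jump has_symm_deriv_dense_iff[OF _ assms(2), of f]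
      symm_quotient_tendsto_increments[of f t _ T]
    unfolding symm_differentiable_def by blast
qed

end
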